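(* Let $\alpha,\beta,\gamma\in[0,1]$ with $\alpha=\gamma$ and $\beta+\gamma>1$. Then there exists $c'=c'(\alpha,\beta)$ such that, as $n\to\infty$ over even integers, asymptotically almost surely every vertex $v$ of the Kronecker graph $\mathcal{K}(n,\mathbf{P})$ is connected by a path of length at most $c'$ to some vertex of the middle layer $\{x\in\{0,1\}^n: w(x)=n/2\}$.
   Context: Let $\mathbf{P}$ be the symmetric $2\times 2$ matrix with rows and columns indexed by $1,0$, with $\mathbf{P}[1,1]=\alpha$, $\mathbf{P}[1,0]=\mathbf{P}[0,1]=\beta$, $\mathbf{P}[0,0]=\gamma$. The Kronecker graph $\mathcal{K}(n,\mathbf{P})$ is the random graph with vertex set $\{0,1\}^n$ in which two distinct vertices $u,v$ are adjacent with probability $\prod_{i=1}^n\mathbf{P}[u_i,v_i]$, independently for each pair. The weight $w(x)$ is the number of ones in $x$. Throughout, $n$ is assumed even. *)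

theory Defs
  imports "HOL-Probability.Probability" "Graph_Theory.Graph_Theory"
begin

text \<open>The bits 1 and 0 are \<^const>\<open>True\<close> and \<^const>\<open>False\<close>; matrices are indexed by bits.\<close>

definition initiator :: "real \<Rightarrow> real \<Rightarrow> real \<Rightarrow> bool \<Rightarrow> bool \<Rightarrow> real" where
  "initiator \<alpha> \<beta> \<gamma> a b = (if a \<and> b then \<alpha> else if a \<or> b then \<beta> else \<gamma>)"

definition cube :: "nat \<Rightarrow> bool list set" where
  "cube n = {x. length x = n}"

definition weight :: "bool list \<Rightarrow> nat" where
  "weight x = count_list x True"

definition middle_layer :: "nat \<Rightarrow> bool list set" where
  "middle_layer n = {x \<in> cube n. real (weight x) = real n / 2}"

definition adj_prob :: "nat \<Rightarrow> (bool \<Rightarrow> bool \<Rightarrow> real) \<Rightarrow> bool list \<Rightarrow> bool list \<Rightarrow> real" where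
  "adj_prob n P u v = (\<Prod>i<n. P (u ! i) (v ! i))"

definition vertex_pairs :: "nat \<Rightarrow> bool list set set" where
  "vertex_pairs n = {{u, v} | u v. u \<in> cube n \<and> v \<in> cube n \<and> u \<noteq> v}"

text \<open>Well defined when \<open>P\<close> is symmetric.\<close>

definition pair_prob :: "nat \<Rightarrow> (bool \<Rightarrow> bool \<Rightarrow> real) \<Rightarrow> bool list set \<Rightarrow> real" where
  "pair_prob n P e = (THE p. \<exists>u v. e = {u, v} \<and> p = adj_prob n P u v)"

text \<open>A simple undirected graph is represented as a symmetric loop-free digraph.
  The function \<open>X\<close> selects the unordered pairs that are edges.\<close>

definition graph_of :: "nat \<Rightarrow> (bool list set \<Rightarrow> bool) \<Rightarrow> bool list pair_pre_digraph" where
  "graph_of n X =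
     \<lparr>pverts = cube n, parcs = {(u, v). {u, v} \<in> vertex_pairs n \<and> X {u, v}}\<rparr>"

text \<open>One independent Bernoulli variable per unordered pair of distinct vertices.\<close>

definition kronecker_graph ::
    "nat \<Rightarrow> (bool \<Rightarrow> bool \<Rightarrow> real) \<Rightarrow> bool list pair_pre_digraph pmf" where
  "kronecker_graph n P =
     map_pmf (graph_of n)
       (Pi_pmf (vertex_pairs n) False (\<lambda>e. bernoulli_pmf (pair_prob n P e)))"

lemma finite_vertex_pairs: "finite (vertex_pairs n)"
proof (rule finite_subset)
  have "finite {x :: bool list. set x \<subseteq> UNIV \<and> length x = n}"
    by (rule finite_lists_length_eq) simp
  then show "finite (Pow (cube n))"
    by (simp add: cube_def)
qed (auto simp: vertex_pairs_def)

lemma initiator_sym: "initiator \<alpha> \<beta> \<gamma> a b = initiator \<alpha> \<beta> \<gamma> b a"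
  by (auto simp: initiator_def)

lemma pair_prob_doubleton:
  assumes "\<And>a b. P a b = P b a"
  shows "pair_prob n P {u, v} = adj_prob n P u v"
proof -
  have "adj_prob n P u v = adj_prob n P v u"
    unfolding adj_prob_def using assms by (intro prod.cong) auto
  then show ?thesis
    unfolding pair_prob_def by (intro the_equality) (auto simp: doubleton_eq_iff)
qed

lemma prob_adjacent:
  assumes sym: "\<And>a b. P a b = P b a"
    and bnd: "\<And>a b. 0 \<le> P a b \<and> P a b \<le> 1"
    and uv: "u \<in> cube n" "v \<in> cube n" "u \<noteq> v"
  shows "measure_pmf.prob (kronecker_graph n P) {G. (u, v) \<in> parcs G} = adj_prob n P u v"
proof -
  let ?q = "Pi_pmf (vertex_pairs n) False (\<lambda>e. bernoulli_pmf (pair_prob n P e))"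
  have e: "{u, v} \<in> vertex_pairs n"
    using uv by (auto simp: vertex_pairs_def)
  have rng: "0 \<le> adj_prob n P u v" "adj_prob n P u v \<le> 1"
    unfolding adj_prob_def using bnd by (auto intro: prod_nonneg prod_le_1)
  have "measure_pmf.prob (kronecker_graph n P) {G. (u, v) \<in> parcs G}
      = measure_pmf.prob ?q ((\<lambda>X. X {u, v}) -` {True})"
    unfolding kronecker_graph_def measure_map_pmf
    using e by (intro arg_cong[where f = "measure_pmf.prob ?q"]) (auto simp: graph_of_def)
  also have "\<dots> = measure_pmf.prob (map_pmf (\<lambda>X. X {u, v}) ?q) {True}"
    by (simp add: measure_map_pmf)
  also have "map_pmf (\<lambda>X. X {u, v}) ?q = bernoulli_pmf (adj_prob n P u v)"
    using e finite_vertex_pairs by (simp add: Pi_pmf_component pair_prob_doubleton[OF sym])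
  finally show ?thesis
    using rng by (simp add: measure_pmf_single)
qed

end

theory Submission
  imports Defs "HOL-Real_Asymp.Real_Asymp"
begin

text \<open>
  Put \<open>s = \<beta> + \<gamma> > 1\<close>. A random neighbour of \<open>u\<close> typically differs from \<open>u\<close> in a fraction
  \<open>\<beta> / s\<close> of the ones and of the zeros, so the deviation of its weight from \<open>n/2\<close> is
  \<open>(\<gamma> - \<beta>) / s\<close> times that of \<open>u\<close>, up to an additive constant. Taking the largest terms of two
  binomial expansions, the expected number of neighbours with this behaviour is at least
  \<open>s^n / (n + 1)\<^sup>2\<close>. If the deviation of \<open>u\<close> is at most a small multiple of \<open>n\<close>, the
  expected number of neighbours in the middle layer is still exponentially large. Edges being
  independent, the union bound over the \<open>2^n\<close> vertices shows that with probability tending to 1 all these neighbours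
  exist; a bounded number of contracting steps followed by one step into the middle layer gives
  the path.
\<close>

section \<open>Largest terms of binomial expansions\<close>

text \<open>With \<open>b\<close> as \<beta> and \<open>g\<close> as \<gamma>: the total weight of
  flipping exactly \<open>k\<close> of \<open>m\<close> bits, where a flipped bit contributes
  \<beta> and a kept bit \<gamma>.\<close>

definition binom_term :: "real \<Rightarrow> real \<Rightarrow> nat \<Rightarrow> nat \<Rightarrow> real" where
  "binom_term b g m k = real (m choose k) * b ^ k * g ^ (m - k)"

lemma binom_term_nonneg: "0 \<le> b \<Longrightarrow> 0 \<le> g \<Longrightarrow> 0 \<le> binom_term b g m k"
  by (simp add: binom_term_def)

lemma binom_term_pos: "0 < b \<Longrightarrow> 0 < g \<Longrightarrow> k \<le> m \<Longrightarrow> 0 < binom_term b g m k"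
  by (simp add: binom_term_def)

text \<open>The ratio of consecutive terms, cleared of denominators, from the two absorption
  identities for binomial coefficients. It serves to locate the largest term.\<close>

lemma binom_term_Suc:
  assumes "k < m"
  shows "binom_term b g m (Suc k) * (real k + 1) * g = binom_term b g m k * (real m - real k) * b"
proof -
  have "Suc k * (m choose Suc k) = (m - k) * (m choose k)"
    by (simp only: binomial_absorption binomial_absorb_comp)
  then have "real (Suc k * (m choose Suc k)) = real ((m - k) * (m choose k))"
    by (rule arg_cong)
  then have *: "(real k + 1) * real (m choose Suc k) = (real m - real k) * real (m choose k)"
    using assms by (simp only: of_nat_mult of_nat_diff of_nat_Suc less_imp_le) (simp add: add.commute)
  have g: "g ^ (m - k) = g * g ^ (m - Suc k)"
    using assms by (metis Suc_diff_Suc power_Suc)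
  have "binom_term b g m (Suc k) * (real k + 1) * g
      = ((real k + 1) * real (m choose Suc k)) * (b ^ Suc k * g ^ (m - Suc k) * g)"
    by (simp add: binom_term_def)
  also have "\<dots> = binom_term b g m k * (real m - real k) * b"
    unfolding * binom_term_def g by simp
  finally show ?thesis .
qed

text \<open>The largest of the \<open>m + 1\<close> terms is at least their average. Comparing it
  with its neighbours places \<open>k\<close> near \<open>m * b / (b + g)\<close>.\<close>

lemma binom_term_mode:
  assumes b: "0 < b" and g: "0 < g"
  obtains k where "k \<le> m" "(b + g) ^ m / (real m + 1) \<le> binom_term b g m k"
    "real m * b - g \<le> real k * (b + g)" "real k * (b + g) \<le> real m * b + b"
proof -
  let ?B = "binom_term b g m"
  have "Max (?B ` {..m}) \<in> ?B ` {..m}" by (intro Max_in) auto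
  then obtain k where k: "k \<le> m" and kM: "?B k = Max (?B ` {..m})" by (auto simp: image_iff)
  have max: "?B j \<le> ?B k" if "j \<le> m" for j
    unfolding kM using that by (intro Max_ge) auto
  have pos: "0 < ?B k" using b g k by (rule binom_term_pos)
  have "(b + g) ^ m = (\<Sum>j\<le>m. ?B j)"
    by (simp add: binomial_ring binom_term_def)
  also have "\<dots> \<le> (\<Sum>j\<le>m. ?B k)" by (intro sum_mono max) auto
  also have "\<dots> = (real m + 1) * ?B k" by simp
  finally have 1: "(b + g) ^ m / (real m + 1) \<le> ?B k"
    by (simp add: divide_le_eq mult.commute)
  \<comment> \<open>Comparison with the next term. For \<open>k = m\<close> there is none, but then
    the bound holds outright.\<close>
  have 2: "real m * b - g \<le> real k * (b + g)"
  proof (cases "k = m")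
    case True
    then show ?thesis using g by (simp add: distrib_left) (smt (verit) mult_nonneg_nonneg of_nat_0_le_iff)
  next
    case False
    then have km: "k < m" using k by simp
    have "?B k * ((real m - real k) * b) = ?B (Suc k) * ((real k + 1) * g)"
      using binom_term_Suc[OF km, of b g] by (simp add: mult.assoc)
    also have "\<dots> \<le> ?B k * ((real k + 1) * g)"
      using max[of "Suc k"] km g by (intro mult_right_mono) auto
    finally have "(real m - real k) * b \<le> (real k + 1) * g"
      using pos by simp
    then show ?thesis by (simp add: algebra_simps)
  qed
  have 3: "real k * (b + g) \<le> real m * b + b"
  proof (cases k)
    case 0
    then show ?thesis using b by simp
  next
    case (Suc j)
    then have jm: "j < m" using k by simp
    have "?B k * ((real j + 1) * g) = ?B j * ((real m - real j) * b)"
      using binom_term_Suc[OF jm, of b g] Suc by (simp add: mult.assoc)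
    also have "\<dots> \<le> ?B k * ((real m - real j) * b)"
      using max[of j] jm b by (intro mult_right_mono) auto
    finally have "(real j + 1) * g \<le> (real m - real j) * b"
      using pos by simp
    then show ?thesis using Suc by (simp add: algebra_simps)
  qed
  show ?thesis using that k 1 2 3 by blast
qed

text \<open>Two applications of Pascal's rule expand each coefficient into a sum that contains the
  previous one.\<close>

lemma choose_le_choose_shift: "m choose k \<le> (m + 2 * d) choose (k + d)"
  by (induction d) auto

text \<open>Adding \<open>d\<close> flipped and \<open>d\<close> kept bits multiplies the weight by
  exactly \<open>(b * g) ^ d\<close>, while the binomial coefficient does not decrease. This bounds
  the cost of being at distance \<open>d\<close> from the middle.\<close>

lemma binom_term_shift:
  assumes b: "0 \<le> b" and g: "0 \<le> g" and k: "k \<le> m"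
  shows "(b * g) ^ d * binom_term b g m k \<le> binom_term b g (m + 2 * d) (k + d)"
proof -
  have e: "m + 2 * d - (k + d) = (m - k) + d" using k by simp
  have "(b * g) ^ d * binom_term b g m k
      = real (m choose k) * (b ^ (k + d) * g ^ ((m - k) + d))"
    by (simp add: binom_term_def power_add power_mult_distrib)
  also have "\<dots> \<le> real ((m + 2 * d) choose (k + d)) * (b ^ (k + d) * g ^ ((m - k) + d))"
    using b g choose_le_choose_shift[of m k d] by (intro mult_right_mono) auto
  finally show ?thesis by (simp add: binom_term_def e)
qed

section \<open>Expected numbers of neighbours of given weight\<close>

definition flip :: "bool list \<Rightarrow> nat set \<Rightarrow> bool list" where
  "flip u F = map (\<lambda>i. (u ! i) \<noteq> (i \<in> F)) [0..<length u]"

lemma length_flip [simp]: "length (flip u F) = length u"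
  by (simp add: flip_def)

lemma nth_flip [simp]: "i < length u \<Longrightarrow> flip u F ! i = ((u ! i) \<noteq> (i \<in> F))"
  by (simp add: flip_def)

lemma flip_inj:
  assumes "flip u F = flip u F'" "F \<subseteq> {..<length u}" "F' \<subseteq> {..<length u}"
  shows "F = F'"
proof -
  have "i \<in> F \<longleftrightarrow> i \<in> F'" if "i < length u" for i
    using arg_cong[OF assms(1), of "\<lambda>v. v ! i"] that by auto
  then show ?thesis using assms(2,3) by blast
qed

lemma weight_eq_card: "weight u = card {i. i < length u \<and> u ! i}"
  by (simp add: weight_def count_list_eq_length_filter length_filter_conv_card)

lemma weight_le_length: "weight u \<le> length u"
  by (simp add: weight_def count_le_length)

lemma card_zeros: "card {i. i < length u \<and> \<not> u ! i} = length u - weight u"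
proof -
  have "{i. i < length u \<and> \<not> u ! i} = {..<length u} - {i. i < length u \<and> u ! i}" by auto
  moreover have "card \<dots> = length u - weight u"
    by (subst card_Diff_subset) (auto simp: weight_eq_card)
  ultimately show ?thesis by simp
qed

text \<open>Flipping \<open>A\<close> loses ones and flipping \<open>B\<close> gains them. The
  additive form avoids truncated subtraction on \<open>nat\<close>.\<close>

lemma weight_flip:
  assumes "A \<subseteq> {i. i < length u \<and> u ! i}" "B \<subseteq> {i. i < length u \<and> \<not> u ! i}"
  shows "weight (flip u (A \<union> B)) + card A = weight u + card B"
proof -
  let ?O = "{i. i < length u \<and> u ! i}"
  have fin: "finite A" "finite B"
    using assms by (auto intro: finite_subset[of _ "{..<length u}"])
  have "{i. i < length (flip u (A \<union> B)) \<and> flip u (A \<union> B) ! i} = (?O - A) \<union> B"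
    using assms by auto
  then have "weight (flip u (A \<union> B)) = card ((?O - A) \<union> B)"
    by (simp add: weight_eq_card)
  also have "\<dots> = card (?O - A) + card B"
    using fin assms by (intro card_Un_disjoint) auto
  also have "card (?O - A) = weight u - card A"
    using fin assms by (simp add: card_Diff_subset weight_eq_card)
  finally show ?thesis
    using card_mono[OF _ assms(1)] by (simp add: weight_eq_card)
qed

text \<open>Since \<alpha> = \<gamma>, written \<open>initiator \<gamma> \<beta> \<gamma>\<close>, a
  matrix entry depends only on whether the two bits agree. Hence only the number of differing
  positions matters.\<close>

lemma adj_prob_flip:
  assumes "u \<in> cube n" "F \<subseteq> {..<n}"
  shows "adj_prob n (initiator \<gamma> \<beta> \<gamma>) u (flip u F) = \<beta> ^ card F * \<gamma> ^ (n - card F)"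
proof -
  have len: "length u = n" using assms by (simp add: cube_def)
  have "adj_prob n (initiator \<gamma> \<beta> \<gamma>) u (flip u F) = (\<Prod>i<n. if i \<in> F then \<beta> else \<gamma>)"
    unfolding adj_prob_def using len by (intro prod.cong) (auto simp: initiator_def)
  also have "\<dots> = \<beta> ^ card ({..<n} \<inter> F) * \<gamma> ^ card ({..<n} \<inter> - F)"
    by (simp add: prod.If_cases)
  also have "{..<n} \<inter> F = F" using assms by auto
  also have "{..<n} \<inter> - F = {..<n} - F" by auto
  also have "card ({..<n} - F) = n - card F"
    using assms finite_subset[of F "{..<n}"] by (simp add: card_Diff_subset)
  finally show ?thesis .
qed

lemma adj_prob_nonneg:
  assumes "0 \<le> \<beta>" "0 \<le> \<gamma>"
  shows "0 \<le> adj_prob n (initiator \<gamma> \<beta> \<gamma>) u v"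
  unfolding adj_prob_def using assms by (intro prod_nonneg) (auto simp: initiator_def)

lemma finite_cube [simp]: "finite (cube n)"
  using finite_lists_length_eq[of "UNIV :: bool set" n] by (simp add: cube_def)

lemma card_cube: "card (cube n) = 2 ^ n"
  using card_lists_length_eq[of "UNIV :: bool set" n] by (simp add: cube_def)

text \<open>Flipping \<open>a\<close> ones and \<open>c\<close> zeros of \<open>u\<close> yields
  pairwise distinct vertices of equal adjacency probability, all of the weight that forces them into
  \<open>S\<close>. Their number times that probability factors into the two binomial terms.\<close>

lemma sum_adj_prob_ge:
  assumes b: "0 \<le> \<beta>" and g: "0 \<le> \<gamma>" and u: "u \<in> cube n"
    and a: "a \<le> weight u" and c: "c \<le> n - weight u"
    and S: "S \<subseteq> cube n" "\<And>v. v \<in> cube n \<Longrightarrow> weight v + a = weight u + c \<Longrightarrow> v \<in> S"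
  shows "binom_term \<beta> \<gamma> (weight u) a * binom_term \<beta> \<gamma> (n - weight u) c
    \<le> (\<Sum>v\<in>S. adj_prob n (initiator \<gamma> \<beta> \<gamma>) u v)"
proof -
  let ?P = "initiator \<gamma> \<beta> \<gamma>"
  have len: "length u = n" using u by (simp add: cube_def)
  have wn: "weight u \<le> n" using weight_le_length[of u] len by simp
  define Os where "Os = {i. i < length u \<and> u ! i}"
  define Zs where "Zs = {i. i < length u \<and> \<not> u ! i}"
  have fin: "finite Os" "finite Zs" by (auto simp: Os_def Zs_def)
  have dj: "Os \<inter> Zs = {}" and sub: "Os \<subseteq> {..<n}" "Zs \<subseteq> {..<n}"
    using len by (auto simp: Os_def Zs_def)
  define I where "I = {A. A \<subseteq> Os \<and> card A = a} \<times> {B. B \<subseteq> Zs \<and> card B = c}"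
  define h where "h = (\<lambda>(A, B). flip u (A \<union> B))"
  have cardI: "card I = (weight u choose a) * ((n - weight u) choose c)"
    using fin card_zeros[of u] len
    by (simp add: I_def card_cartesian_product n_subsets Os_def Zs_def weight_eq_card)
  have inj: "inj_on h I"
  proof (rule inj_onI)
    fix x y assume x: "x \<in> I" and y: "y \<in> I" and eq: "h x = h y"
    obtain A B where AB: "x = (A, B)" by (cases x)
    obtain A' B' where AB': "y = (A', B')" by (cases y)
    have s: "A \<subseteq> Os" "B \<subseteq> Zs" "A' \<subseteq> Os" "B' \<subseteq> Zs"
      using x y AB AB' by (auto simp: I_def)
    have "A \<union> B = A' \<union> B'"
      by (rule flip_inj[of u]) (use eq AB AB' s sub len in \<open>auto simp: h_def\<close>)
    \<comment> \<open>\<open>A\<close> and \<open>B\<close> are recovered from their union by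
      intersecting with the disjoint sets of ones and zeros.\<close>
    then have "(A \<union> B) \<inter> Os = (A' \<union> B') \<inter> Os" "(A \<union> B) \<inter> Zs = (A' \<union> B') \<inter> Zs" by auto
    then have "A = A'" "B = B'" using s dj by blast+
    then show "x = y" using AB AB' by simp
  qed
  have val: "adj_prob n ?P u (h x) = \<beta> ^ (a + c) * \<gamma> ^ (n - (a + c))" and mem: "h x \<in> S"
    if x: "x \<in> I" for x
  proof -
    obtain A B where AB: "x = (A, B)" by (cases x)
    have s: "A \<subseteq> Os" "B \<subseteq> Zs" "card A = a" "card B = c"
      using x AB by (auto simp: I_def)
    have "card (A \<union> B) = a + c"
      using s fin dj by (subst card_Un_disjoint) (auto dest: finite_subset)
    then show "adj_prob n ?P u (h x) = \<beta> ^ (a + c) * \<gamma> ^ (n - (a + c))"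
      using adj_prob_flip[OF u, of "A \<union> B" \<gamma> \<beta>] s sub AB by (auto simp: h_def)
    have "weight (flip u (A \<union> B)) + card A = weight u + card B"
      using s by (intro weight_flip) (auto simp: Os_def Zs_def)
    then show "h x \<in> S"
      using s len AB by (intro S(2)) (auto simp: h_def cube_def)
  qed
  have e: "n - (a + c) = (weight u - a) + (n - weight u - c)"
    using a c wn by simp
  have "binom_term \<beta> \<gamma> (weight u) a * binom_term \<beta> \<gamma> (n - weight u) c
      = real (card I) * (\<beta> ^ (a + c) * \<gamma> ^ (n - (a + c)))"
    unfolding e cardI by (simp add: binom_term_def power_add)
  also have "\<dots> = (\<Sum>x\<in>I. adj_prob n ?P u (h x))"
    using val by simp
  also have "\<dots> = (\<Sum>v\<in>h ` I. adj_prob n ?P u v)"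
    using inj by (simp add: sum.reindex)
  also have "\<dots> \<le> (\<Sum>v\<in>S. adj_prob n ?P u v)"
    using mem S(1) adj_prob_nonneg[OF b g] finite_subset[OF S(1) finite_cube]
    by (intro sum_mono2) auto
  finally show ?thesis .
qed

section \<open>Neighbours closer to the middle layer and neighbours inside it\<close>

definition deviation :: "nat \<Rightarrow> bool list \<Rightarrow> real" where
  "deviation n u = \<bar>real (weight u) - real n / 2\<bar>"

text \<open>The summand 1 absorbs the rounding errors in the numbers of flipped ones and
  zeros.\<close>

definition contracted :: "nat \<Rightarrow> real \<Rightarrow> bool list \<Rightarrow> bool list set" where
  "contracted n q u = {v \<in> cube n. deviation n v \<le> q * deviation n u + 1}"

text \<open>The numbers \<open>a\<close> of flipped ones and \<open>c\<close> of flipped zeros are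
  taken at the modes of their binomial expansions. The location of the modes gives the contraction,
  their size the lower bound.\<close>

lemma sum_adj_prob_contracted:
  assumes b: "0 < \<beta>" and g: "0 < \<gamma>" and u: "u \<in> cube n"
  shows "(\<beta> + \<gamma>) ^ n / (real n + 1)\<^sup>2
    \<le> (\<Sum>v\<in>contracted n (\<bar>\<gamma> - \<beta>\<bar> / (\<beta> + \<gamma>)) u. adj_prob n (initiator \<gamma> \<beta> \<gamma>) u v)"
proof -
  define w where "w = weight u"
  define s where "s = \<beta> + \<gamma>"
  have s: "0 < s" using b g by (simp add: s_def)
  have wn: "w \<le> n" using weight_le_length[of u] u by (simp add: w_def cube_def)
  obtain a where a: "a \<le> w" "s ^ w / (real w + 1) \<le> binom_term \<beta> \<gamma> w a"
    "real w * \<beta> - \<gamma> \<le> real a * s" "real a * s \<le> real w * \<beta> + \<beta>"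
    using binom_term_mode[OF b g, of w] unfolding s_def by blast
  obtain c where c: "c \<le> n - w" "s ^ (n - w) / (real (n - w) + 1) \<le> binom_term \<beta> \<gamma> (n - w) c"
    "real (n - w) * \<beta> - \<gamma> \<le> real c * s" "real c * s \<le> real (n - w) * \<beta> + \<beta>"
    using binom_term_mode[OF b g, of "n - w"] unfolding s_def by blast
  have "s ^ n / (real n + 1)\<^sup>2 = (s ^ w / (real n + 1)) * (s ^ (n - w) / (real n + 1))"
    using wn by (simp add: power2_eq_square flip: power_add)
  also have "\<dots> \<le> (s ^ w / (real w + 1)) * (s ^ (n - w) / (real (n - w) + 1))"
    using wn s by (intro mult_mono divide_left_mono) auto
  also have "\<dots> \<le> binom_term \<beta> \<gamma> w a * binom_term \<beta> \<gamma> (n - w) c"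
    using a(2) c(2) s b g by (intro mult_mono) (auto intro!: binom_term_nonneg)
  also have "\<dots> \<le> (\<Sum>v\<in>contracted n (\<bar>\<gamma> - \<beta>\<bar> / s) u. adj_prob n (initiator \<gamma> \<beta> \<gamma>) u v)"
    unfolding w_def
  proof (rule sum_adj_prob_ge)
    show "a \<le> weight u" "c \<le> n - weight u" using a(1) c(1) by (simp_all add: w_def)
    fix v assume v: "v \<in> cube n" and wv: "weight v + a = weight u + c"
    have wv': "real (weight v) = real w - real a + real c"
      using arg_cong[OF wv, of real] by (simp add: w_def)
    define x where "x = real w - real n / 2"
    \<comment> \<open>Scaled distances of \<open>a\<close> and \<open>c\<close> from the ideal
      values \<open>w * \<beta> / s\<close> and \<open>(n - w) * \<beta> / s\<close>. Both lie
      between \<open>- \<gamma>\<close> and \<beta>, so they differ by at most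
      \<open>s\<close>.\<close>
    define e1 where "e1 = real a * s - real w * \<beta>"
    define e2 where "e2 = real c * s - real (n - w) * \<beta>"
    have "s * (real (weight v) - real n / 2) = (\<gamma> - \<beta>) * x + (e2 - e1)"
      using wn unfolding wv' x_def e1_def e2_def s_def
      by (simp add: of_nat_diff field_simps)
    moreover have "\<bar>(\<gamma> - \<beta>) * x + (e2 - e1)\<bar> \<le> \<bar>\<gamma> - \<beta>\<bar> * \<bar>x\<bar> + \<bar>e2 - e1\<bar>"
      by (metis abs_mult abs_triangle_ineq)
    moreover have "\<bar>e2 - e1\<bar> \<le> s"
      using a(3,4) c(3,4) by (simp add: e1_def e2_def s_def abs_le_iff)
    ultimately have "s * deviation n v \<le> \<bar>\<gamma> - \<beta>\<bar> * \<bar>x\<bar> + s"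
      using s by (simp add: deviation_def abs_mult flip: abs_mult_pos')
    also have "\<dots> = s * (\<bar>\<gamma> - \<beta>\<bar> / s * deviation n u + 1)"
      using s by (simp add: deviation_def x_def w_def field_simps)
    finally have "deviation n v \<le> \<bar>\<gamma> - \<beta>\<bar> / s * deviation n u + 1"
      using s by simp
    then show "v \<in> contracted n (\<bar>\<gamma> - \<beta>\<bar> / s) u"
      using v by (simp add: contracted_def)
  qed (use b g u in \<open>auto simp: contracted_def\<close>)
  finally show ?thesis by (simp add: s_def)
qed

text \<open>If one bit value occurs \<open>m\<close> times and the other \<open>m + 2 * d\<close>
  times, flipping \<open>k\<close> of the former and \<open>k + d\<close> of the latter lands
  exactly in the middle. Compared with \<open>s ^ n\<close>, this loses a factor of at most
  \<open>r ^ (K * d)\<close>, hence at most \<open>r ^ n\<close>, which still leaves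
  \<open>r ^ n\<close>.\<close>

lemma sum_adj_prob_middle_layer:
  assumes b: "0 < \<beta>" and g: "0 < \<gamma>" and u: "u \<in> cube n" and n: "even n"
    and r: "1 \<le> r" "r\<^sup>2 = \<beta> + \<gamma>" and K: "(\<beta> + \<gamma>)\<^sup>2 \<le> \<beta> * \<gamma> * r ^ K"
    and dev: "real K * deviation n u \<le> real n"
  shows "r ^ n / (real n + 1)\<^sup>2
    \<le> (\<Sum>v\<in>middle_layer n. adj_prob n (initiator \<gamma> \<beta> \<gamma>) u v)"
proof -
  define s where "s = \<beta> + \<gamma>"
  have s: "0 < s" using b g by (simp add: s_def)
  define w where "w = weight u"
  have wn: "w \<le> n" using weight_le_length[of u] u by (simp add: w_def cube_def)
  obtain h where h: "n = 2 * h" using n by (auto elim: evenE)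
  define m where "m = min w (n - w)"
  define d where "d = h - m"
  have nmd: "n = 2 * m + 2 * d" and cases: "w = m + 2 * d \<and> n - w = m \<or> w = m \<and> n - w = m + 2 * d"
    using wn h by (auto simp: m_def d_def min_def)
  have "deviation n u = real d"
    unfolding deviation_def w_def[symmetric] using cases nmd by (auto simp: field_simps)
  then have "real (K * d) \<le> real n" using dev by simp
  then have Kd: "K * d \<le> n" by (simp only: of_nat_le_iff)
  obtain k where k: "k \<le> m" "s ^ m / (real m + 1) \<le> binom_term \<beta> \<gamma> m k"
    using binom_term_mode[OF b g, of m] unfolding s_def by blast
  have pos: "0 \<le> binom_term \<beta> \<gamma> i j" for i j
    using b g by (intro binom_term_nonneg) auto
  \<comment> \<open>One factor \<open>r ^ n\<close> pays for the imbalance \<open>d\<close>, through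
    the choice of \<open>K\<close> and \<open>K * d \<le> n\<close>; the other survives.\<close>
  have "r ^ n * r ^ n = s ^ n"
    using r(2) by (simp add: s_def power2_eq_square flip: power_mult_distrib)
  also have "\<dots> = s ^ (2 * m) * (s\<^sup>2) ^ d"
    by (simp add: nmd power_add flip: power_mult)
  also have "\<dots> \<le> s ^ (2 * m) * (\<beta> * \<gamma> * r ^ K) ^ d"
    using K s by (intro mult_left_mono power_mono) (auto simp: s_def)
  also have "\<dots> = s ^ (2 * m) * (\<beta> * \<gamma>) ^ d * r ^ (K * d)"
    by (simp add: power_mult_distrib flip: power_mult)
  also have "\<dots> \<le> s ^ (2 * m) * (\<beta> * \<gamma>) ^ d * r ^ n"
    using r(1) Kd s b g by (intro mult_left_mono power_increasing) auto
  finally have rn: "r ^ n \<le> s ^ (2 * m) * (\<beta> * \<gamma>) ^ d"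
    using r(1) by simp
  have "r ^ n / (real n + 1)\<^sup>2 \<le> s ^ (2 * m) * (\<beta> * \<gamma>) ^ d / (real m + 1)\<^sup>2"
    using rn r(1) nmd b g s by (intro frac_le power_mono) auto
  also have "\<dots> = (\<beta> * \<gamma>) ^ d * (s ^ m / (real m + 1)) * (s ^ m / (real m + 1))"
    by (simp add: power2_eq_square power_add mult_2)
  also have "\<dots> \<le> (\<beta> * \<gamma>) ^ d * binom_term \<beta> \<gamma> m k * binom_term \<beta> \<gamma> m k"
    using k(2) b g s pos by (intro mult_mono mult_left_mono) auto
  also have "\<dots> \<le> binom_term \<beta> \<gamma> (m + 2 * d) (k + d) * binom_term \<beta> \<gamma> m k"
    using b g pos k(1) by (intro mult_right_mono binom_term_shift) auto
  also have "\<dots> \<le> (\<Sum>v\<in>middle_layer n. adj_prob n (initiator \<gamma> \<beta> \<gamma>) u v)"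
    using cases
  proof
    assume w: "w = m + 2 * d \<and> n - w = m"
    have "binom_term \<beta> \<gamma> (weight u) (k + d) * binom_term \<beta> \<gamma> (n - weight u) k
      \<le> (\<Sum>v\<in>middle_layer n. adj_prob n (initiator \<gamma> \<beta> \<gamma>) u v)"
      using b g u k(1) w nmd
      by (intro sum_adj_prob_ge) (auto simp: middle_layer_def w_def)
    then show ?thesis using w unfolding w_def by metis
  next
    assume w: "w = m \<and> n - w = m + 2 * d"
    have "binom_term \<beta> \<gamma> (weight u) k * binom_term \<beta> \<gamma> (n - weight u) (k + d)
      \<le> (\<Sum>v\<in>middle_layer n. adj_prob n (initiator \<gamma> \<beta> \<gamma>) u v)"
      using b g u k(1) w nmd
      by (intro sum_adj_prob_ge) (auto simp: middle_layer_def w_def)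
    then show ?thesis using w unfolding w_def by (metis mult.commute)
  qed
  finally show ?thesis .
qed

section \<open>Existence of neighbours with high probability\<close>

definition edge_pmf :: "nat \<Rightarrow> (bool \<Rightarrow> bool \<Rightarrow> real) \<Rightarrow> (bool list set \<Rightarrow> bool) pmf" where
  "edge_pmf n P = Pi_pmf (vertex_pairs n) False (\<lambda>e. bernoulli_pmf (pair_prob n P e))"

definition meets :: "(bool list set \<Rightarrow> bool) \<Rightarrow> bool list \<Rightarrow> bool list set \<Rightarrow> bool" where
  "meets X u S \<longleftrightarrow> (\<exists>v\<in>S. u = v \<or> X {u, v})"

text \<open>By independence the failure probability is a product of factors \<open>1 - p\<close>,
  each at most \<open>exp (- p)\<close>. For \<open>u \<in> S\<close> failure is impossible.\<close>

lemma prob_not_meets: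
  assumes sym: "\<And>a b. P a b = P b a"
    and bnd: "\<And>a b. 0 \<le> P a b \<and> P a b \<le> 1"
    and u: "u \<in> cube n" and S: "S \<subseteq> cube n"
  shows "measure_pmf.prob (edge_pmf n P) {X. \<not> meets X u S} \<le> exp (- (\<Sum>v\<in>S. adj_prob n P u v))"
proof (cases "u \<in> S")
  case True
  then have "{X. \<not> meets X u S} = {}" by (auto simp: meets_def)
  then show ?thesis by simp
next
  case False
  define E where "E = (\<lambda>v. {u, v}) ` S"
  have E: "E \<subseteq> vertex_pairs n"
    using u S False by (auto simp: E_def vertex_pairs_def)
  have inj: "inj_on (\<lambda>v. {u, v}) S"
    by (auto simp: inj_on_def doubleton_eq_iff)
  have rng: "0 \<le> adj_prob n P u v" "adj_prob n P u v \<le> 1" for v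
    unfolding adj_prob_def using bnd by (auto intro: prod_nonneg prod_le_1)
  \<comment> \<open>Failure is a product event: pairs in \<open>E\<close> must be absent, all others
    are free and contribute the factor 1.\<close>
  let ?B = "\<lambda>e. if e \<in> E then {False} else UNIV"
  have "{X. \<not> meets X u S} = Pi (vertex_pairs n) ?B"
    using E False by (auto simp: meets_def E_def Pi_def split: if_splits)
  then have "measure_pmf.prob (edge_pmf n P) {X. \<not> meets X u S}
    = (\<Prod>e\<in>vertex_pairs n. measure_pmf.prob (bernoulli_pmf (pair_prob n P e)) (?B e))"
    unfolding edge_pmf_def by (simp add: measure_Pi_pmf_Pi[OF finite_vertex_pairs])
  also have "\<dots> = (\<Prod>e\<in>E. measure_pmf.prob (bernoulli_pmf (pair_prob n P e)) (?B e))"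
    using E finite_vertex_pairs by (intro prod.mono_neutral_right) auto
  also have "\<dots> = (\<Prod>v\<in>S. 1 - adj_prob n P u v)"
    using inj rng unfolding E_def
    by (subst prod.reindex) (auto simp: pair_prob_doubleton[OF sym] measure_pmf_single intro!: prod.cong)
  also have "\<dots> \<le> (\<Prod>v\<in>S. exp (- adj_prob n P u v))"
    using rng exp_ge_add_one_self[of "- adj_prob n P u v" for v]
    by (intro prod_mono) auto
  also have "\<dots> = exp (- (\<Sum>v\<in>S. adj_prob n P u v))"
    using finite_subset[OF S finite_cube] by (simp add: exp_sum flip: sum_negf)
  finally show ?thesis .
qed

lemma prob_all_meet:
  assumes sym: "\<And>a b. P a b = P b a"
    and bnd: "\<And>a b. 0 \<le> P a b \<and> P a b \<le> 1"
    and U: "U \<subseteq> cube n" and S: "\<And>u. u \<in> U \<Longrightarrow> S u \<subseteq> cube n"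
    and L: "\<And>u. u \<in> U \<Longrightarrow> L \<le> (\<Sum>v\<in>S u. adj_prob n P u v)"
  shows "measure_pmf.prob (edge_pmf n P) {X. \<exists>u\<in>U. \<not> meets X u (S u)} \<le> 2 ^ n * exp (- L)"
proof -
  have fin: "finite U" using U by (rule finite_subset) simp
  have "{X. \<exists>u\<in>U. \<not> meets X u (S u)} = (\<Union>u\<in>U. {X. \<not> meets X u (S u)})" by auto
  then have "measure_pmf.prob (edge_pmf n P) {X. \<exists>u\<in>U. \<not> meets X u (S u)}
      \<le> (\<Sum>u\<in>U. measure_pmf.prob (edge_pmf n P) {X. \<not> meets X u (S u)})"
    using fin by (simp add: measure_UNION_le)
  also have "\<dots> \<le> (\<Sum>u\<in>U. exp (- L))"
  proof (rule sum_mono)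
    fix u assume u: "u \<in> U"
    then have "measure_pmf.prob (edge_pmf n P) {X. \<not> meets X u (S u)}
        \<le> exp (- (\<Sum>v\<in>S u. adj_prob n P u v))"
      using U S by (intro prob_not_meets[OF sym bnd]) auto
    also have "\<dots> \<le> exp (- L)" using L[OF u] by simp
    finally show "measure_pmf.prob (edge_pmf n P) {X. \<not> meets X u (S u)} \<le> exp (- L)" .
  qed
  also have "\<dots> = real (card U) * exp (- L)" by simp
  also have "\<dots> \<le> 2 ^ n * exp (- L)"
  proof (rule mult_right_mono)
    have "real (card U) \<le> real (2 ^ n)"
      using card_mono[OF finite_cube U] by (simp only: of_nat_le_iff card_cube)
    then show "real (card U) \<le> 2 ^ n" by simp
  qed simp
  finally show ?thesis .
qed

section \<open>Paths to the middle layer\<close>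

text \<open>Concatenated contracting steps may revisit vertices, so closed subwalks are cut out
  until the vertices are distinct.\<close>

lemma (in wf_digraph) apath_of_awalk:
  assumes "awalk u p v"
  obtains p' where "apath u p' v" "length p' \<le> length p"
  using assms
proof (induction "length p" arbitrary: p thesis rule: less_induct)
  case less
  show ?case
  proof (cases "distinct (awalk_verts u p)")
    case True
    then show ?thesis using less.prems by (auto simp: apath_def)
  next
    case False
    then obtain q r t w where d: "p = q @ r @ t" "0 < length r" "awalk u q w" "awalk w t v"
      using awalk_not_distinct_decomp[OF less.prems(2)] by blast
    have "awalk u (q @ t) v" using d(3,4) by (rule awalk_appendI)
    moreover have "length (q @ t) < length p" using d by simp
    ultimately obtain p' where "apath u p' v" "length p' \<le> length (q @ t)"
      using less.hyps by blast
    then show ?thesis using less.prems(1) d by simp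
  qed
qed

lemma pverts_graph_of: "pverts (graph_of n X) = cube n"
  by (simp add: graph_of_def)

lemma wf_graph_of: "wf_digraph (with_proj (graph_of n X))"
  by unfold_locales (auto simp: graph_of_def vertex_pairs_def doubleton_eq_iff)

lemma awalk_of_meets:
  assumes u: "u \<in> cube n" and S: "S \<subseteq> cube n" and m: "meets X u S"
  obtains v p where "v \<in> S" "pre_digraph.awalk (with_proj (graph_of n X)) u p v" "length p \<le> 1"
proof -
  interpret G: wf_digraph "with_proj (graph_of n X)" by (rule wf_graph_of)
  obtain v where v: "v \<in> S" "u = v \<or> X {u, v}" using m by (auto simp: meets_def)
  show ?thesis
  proof (cases "u = v")
    case True
    then have "G.awalk u [] v" using u by (simp add: G.awalk_Nil_iff pverts_graph_of)
    then show ?thesis using that v by force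
  next
    case False
    then have "(u, v) \<in> parcs (graph_of n X)"
      using u v S by (auto simp: graph_of_def vertex_pairs_def)
    then have "G.awalk u [(u, v)] v"
      using v S by (auto simp: G.awalk_Cons_iff G.awalk_Nil_iff pverts_graph_of)
    then show ?thesis using that v by force
  qed
qed

text \<open>The deterministic part: \<open>k\<close> contracting steps bring the deviation below the
  threshold of \<open>final\<close>, and one more step enters the middle layer.\<close>

lemma apath_to_middle_layer:
  fixes q :: real and K k :: nat
  assumes q: "0 \<le> q" "q < 1" and k: "real K * q ^ k \<le> 1" and n: "2 * real K / (1 - q) \<le> real n"
    and contr: "\<And>u. u \<in> cube n \<Longrightarrow> meets X u (contracted n q u)"
    and final: "\<And>u. u \<in> cube n \<Longrightarrow> real K * deviation n u \<le> real n \<Longrightarrow> meets X u (middle_layer n)"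
    and u: "u \<in> cube n"
  shows "\<exists>x\<in>middle_layer n. \<exists>p. pre_digraph.apath (with_proj (graph_of n X)) u p x \<and> length p \<le> Suc k"
proof -
  interpret G: wf_digraph "with_proj (graph_of n X)" by (rule wf_graph_of)
  \<comment> \<open>Iterating \<open>x \<mapsto> q * x + 1\<close>, whose fixed point is
    \<open>1 / (1 - q)\<close>. The length is only bounded by \<open>j\<close> because a step may be
    empty.\<close>
  have "\<exists>v\<in>cube n. \<exists>p. G.awalk u p v \<and> length p \<le> j \<and>
      deviation n v \<le> q ^ j * deviation n u + 1 / (1 - q)" for j
  proof (induction j)
    case 0
    have "G.awalk u [] u" using u by (simp add: G.awalk_Nil_iff pverts_graph_of)
    then show ?case using u q by force
  next
    case (Suc j)
    then obtain v p where v: "v \<in> cube n" and p: "G.awalk u p v" "length p \<le> j"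
      and dv: "deviation n v \<le> q ^ j * deviation n u + 1 / (1 - q)" by blast
    obtain v' p' where v': "v' \<in> contracted n q v" and p': "G.awalk v p' v'" "length p' \<le> 1"
      using awalk_of_meets[OF v _ contr[OF v]] by (auto simp: contracted_def)
    have "deviation n v' \<le> q * deviation n v + 1" using v' by (simp add: contracted_def)
    also have "\<dots> \<le> q * (q ^ j * deviation n u + 1 / (1 - q)) + 1"
      using dv q by (intro add_right_mono mult_left_mono) auto
    also have "\<dots> = q ^ Suc j * deviation n u + 1 / (1 - q)"
      using q by (simp add: field_simps)
    finally have "deviation n v' \<le> q ^ Suc j * deviation n u + 1 / (1 - q)" .
    moreover have "G.awalk u (p @ p') v'" using p(1) p'(1) by (rule G.awalk_appendI)
    moreover have "length (p @ p') \<le> Suc j" using p(2) p'(2) by simp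
    moreover have "v' \<in> cube n" using v' by (simp add: contracted_def)
    ultimately show ?case by blast
  qed
  from this[of k] obtain v p where v: "v \<in> cube n" and p: "G.awalk u p v" "length p \<le> k"
    and dv: "deviation n v \<le> q ^ k * deviation n u + 1 / (1 - q)" by blast
  have "deviation n u \<le> real n / 2"
    using weight_le_length[of u] u by (auto simp: deviation_def cube_def abs_le_iff field_simps)
  then have "(real K * q ^ k) * deviation n u \<le> 1 * (real n / 2)"
    using k by (intro mult_mono) (auto simp: deviation_def)
  moreover have "real K * deviation n v \<le> real K * (q ^ k * deviation n u + 1 / (1 - q))"
    using dv by (intro mult_left_mono) auto
  \<comment> \<open>The hypotheses \<open>k\<close> and \<open>n\<close> bound the two summands by
    \<open>n / 2\<close> each.\<close>
  ultimately have "real K * deviation n v \<le> real n"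
    using n by (simp add: distrib_left mult.assoc)
  then obtain x p' where x: "x \<in> middle_layer n" and p': "G.awalk v p' x" "length p' \<le> 1"
    using awalk_of_meets[OF v _ final[OF v]] by (auto simp: middle_layer_def)
  obtain p'' where "G.apath u p'' x" "length p'' \<le> length (p @ p')"
    using G.apath_of_awalk[OF G.awalk_appendI[OF p(1) p'(1)]] by blast
  then show ?thesis using x p(2) p'(2) by (intro bexI[of _ x] exI[of _ p'']) auto
qed

section \<open>Choice of the constants, union bound and limit\<close>

theorem theorem7:
  fixes \<alpha> \<beta> \<gamma> :: real
  assumes "\<alpha> \<in> {0..1}" and "\<beta> \<in> {0..1}" and "\<gamma> \<in> {0..1}"
    and "\<alpha> = \<gamma>" and "\<beta> + \<gamma> > 1"
  shows "\<exists>c' :: nat.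
    ((\<lambda>n. measure_pmf.prob (kronecker_graph n (initiator \<alpha> \<beta> \<gamma>))
        {G. \<forall>v \<in> pverts G. \<exists>x \<in> middle_layer n. \<exists>p.
              pre_digraph.apath (with_proj G) v p x \<and> length p \<le> c'})
      \<longlongrightarrow> 1) (inf sequentially (principal {n. even n}))"
proof -
  define P where "P = initiator \<gamma> \<beta> \<gamma>"
  have b: "0 < \<beta>" and g: "0 < \<gamma>" using assms by auto
  have sym: "P i j = P j i" and bnd: "0 \<le> P i j \<and> P i j \<le> 1" for i j
    using assms by (auto simp: P_def initiator_def)
  define s where "s = \<beta> + \<gamma>"
  have s: "1 < s" using assms by (simp add: s_def)
  \<comment> \<open>The square root splits the growth \<open>s ^ n\<close> into two equal factors,
    each still exponentially large.\<close>
  define r where "r = sqrt s"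
  have r: "1 < r" "r\<^sup>2 = s" using s by (auto simp: r_def)
  define q where "q = \<bar>\<gamma> - \<beta>\<bar> / s"
  have q: "0 \<le> q" "q < 1" using b g by (auto simp: q_def s_def)
  obtain K where "s\<^sup>2 / (\<beta> * \<gamma>) < r ^ K"
    using real_arch_pow[OF r(1)] by blast
  then have K: "s\<^sup>2 \<le> \<beta> * \<gamma> * r ^ K"
    using b g by (simp add: field_simps)
  \<comment> \<open>\<open>K\<close> and \<open>k\<close> are fixed before \<open>n\<close>, so the
    path length \<open>Suc k\<close> is uniform in \<open>n\<close>. The \<open>+ 1\<close> spares a
    proof that \<open>K\<close> is positive.\<close>
  obtain k where "q ^ k < 1 / (real K + 1)"
    using real_arch_pow_inv[of "1 / (real K + 1)" q] q by auto
  then have "(real K + 1) * q ^ k < 1" by (simp add: field_simps)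
  moreover have "real K * q ^ k \<le> (real K + 1) * q ^ k"
    using q by (intro mult_right_mono) auto
  ultimately have k: "real K * q ^ k \<le> 1" by simp
  define L where "L n = r ^ n / (real n + 1)\<^sup>2" for n
  define good where "good n = {G. \<forall>v \<in> pverts G. \<exists>x \<in> middle_layer n. \<exists>p.
    pre_digraph.apath (with_proj G) v p x \<and> length p \<le> Suc k}" for n
  have lower: "1 - 2 * (2 ^ n * exp (- L n)) \<le> measure_pmf.prob (kronecker_graph n P) (good n)"
    if n: "even n" "2 * real K / (1 - q) \<le> real n" for n
  proof -
    let ?M = "edge_pmf n P"
    let ?B1 = "{X. \<exists>u\<in>cube n. \<not> meets X u (contracted n q u)}"
    let ?U = "{u \<in> cube n. real K * deviation n u \<le> real n}"
    let ?B2 = "{X. \<exists>u\<in>?U. \<not> meets X u (middle_layer n)}"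
    \<comment> \<open>Lets the single bound \<open>L n\<close> serve both kinds of neighbour
      sets.\<close>
    have "r ^ n \<le> s ^ n" using r by (intro power_mono) (auto simp: power2_eq_square)
    then have Ls: "L n \<le> s ^ n / (real n + 1)\<^sup>2" by (simp add: L_def divide_right_mono)
    have 1: "measure_pmf.prob ?M ?B1 \<le> 2 ^ n * exp (- L n)"
    proof (rule prob_all_meet[OF sym bnd])
      fix u assume "u \<in> cube n"
      then show "L n \<le> (\<Sum>v\<in>contracted n q u. adj_prob n P u v)"
        using order_trans[OF Ls[unfolded s_def] sum_adj_prob_contracted[OF b g]]
        by (simp add: q_def s_def P_def)
    qed (auto simp: contracted_def)
    have 2: "measure_pmf.prob ?M ?B2 \<le> 2 ^ n * exp (- L n)"
      using sum_adj_prob_middle_layer[OF b g _ n(1)] r K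
      by (intro prob_all_meet[OF sym bnd]) (auto simp: middle_layer_def L_def P_def s_def)
    have sub: "- (graph_of n -` good n) \<subseteq> ?B1 \<union> ?B2"
    proof
      fix X assume X: "X \<in> - (graph_of n -` good n)"
      show "X \<in> ?B1 \<union> ?B2"
      proof (rule ccontr)
        assume "X \<notin> ?B1 \<union> ?B2"
        then have "graph_of n X \<in> good n"
          unfolding good_def using apath_to_middle_layer[OF q k n(2), of X]
          by (auto simp: graph_of_def)
        then show False using X by simp
      qed
    qed
    have "1 - measure_pmf.prob (kronecker_graph n P) (good n) = measure_pmf.prob ?M (- (graph_of n -` good n))"
      using measure_pmf.prob_compl[of "graph_of n -` good n" ?M]
      by (simp add: kronecker_graph_def edge_pmf_def measure_map_pmf Compl_eq_Diff_UNIV)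
    also have "\<dots> \<le> measure_pmf.prob ?M (?B1 \<union> ?B2)"
      using sub by (intro measure_pmf.finite_measure_mono) auto
    also have "\<dots> \<le> measure_pmf.prob ?M ?B1 + measure_pmf.prob ?M ?B2"
      by (intro measure_Un_le) auto
    finally show ?thesis using 1 2 by simp
  qed
  let ?F = "inf sequentially (principal {n. even n})"
  \<comment> \<open>\<open>L n\<close> grows exponentially, so \<open>exp (- L n)\<close> outweighs
    the number \<open>2 ^ n\<close> of vertices.\<close>
  have "((\<lambda>n. 1 - 2 * (2 ^ n * exp (- L n))) \<longlongrightarrow> 1) sequentially"
    unfolding L_def using r(1) by real_asymp
  \<comment> \<open>The filter of large even integers is finer than \<open>sequentially\<close>, so
    the limit carries over.\<close>
  then have lim: "((\<lambda>n. 1 - 2 * (2 ^ n * exp (- L n))) \<longlongrightarrow> 1) ?F"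
    by (rule tendsto_mono[rotated]) simp
  have "\<forall>\<^sub>F n in sequentially. 2 * real K / (1 - q) \<le> real n"
    by real_asymp
  then have "\<forall>\<^sub>F n in ?F. 1 - 2 * (2 ^ n * exp (- L n)) \<le> measure_pmf.prob (kronecker_graph n P) (good n)"
    unfolding eventually_inf_principal by eventually_elim (use lower in auto)
  then have "((\<lambda>n. measure_pmf.prob (kronecker_graph n P) (good n)) \<longlongrightarrow> 1) ?F"
    by (rule tendsto_sandwich[OF _ _ lim tendsto_const]) simp
  then show ?thesis
    unfolding good_def P_def \<open>\<alpha> = \<gamma>\<close> by (rule exI)
qed

end
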